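(* Let $\mathbb{F}$ be either $\mathbb{R}$, $\mathbb{C}$ or a finite field, let $p,q,m\ge 1$ be integers, and let $A_1,\ldots,A_m\in M_{p,q}(\mathbb{F})$ be linearly independent over $\mathbb{F}$. If the bilinear system defined by $A_1,\ldots,A_m$ is always solvable, then $m\le p+q-1$.
   Context: $M_{p,q}(\mathbb{F})$ denotes the $p$-by-$q$ matrices over $\mathbb{F}$. The bilinear system defined by $A_1,\ldots,A_m$ with right hand side $g=(g_1,\ldots,g_m)^T\in\mathbb{F}^m$ is the system $y^TA_ix=g_i$, $i=1,\ldots,m$, in the unknowns $x\in\mathbb{F}^q$, $y\in\mathbb{F}^p$. It is called always solvable if for every $g\in\mathbb{F}^m$ there exist $x\in\mathbb{F}^q$ and $y\in\mathbb{F}^p$ satisfying all $m$ equations simultaneously. *)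

theory Defs
  imports "HOL-Analysis.Analysis"
begin

text \<open>
  The matrices of size \<open>p\<close> by \<open>q\<close> over \<open>'a\<close> are the elements of \<open>'a^'q^'p\<close>, with
  \<open>p = CARD('p)\<close> and \<open>q = CARD('q)\<close>; a list of \<open>m = CARD('m)\<close> such matrices is a
  function on \<open>'m\<close>. The library makes these matrices a vector space only over the reals, so
  scalar multiplication over an arbitrary field is supplied here.
\<close>

definition matrix_scale :: "'a::field \<Rightarrow> 'a^'q^'p \<Rightarrow> 'a^'q^'p"
  where "matrix_scale c M = (\<chi> i j. c * M $ i $ j)"

interpretation matrix_space: vector_space "matrix_scale :: 'a::field \<Rightarrow> 'a^'q^'p \<Rightarrow> 'a^'q^'p"
  by unfold_locales (simp_all add: matrix_scale_def vec_eq_iff algebra_simps)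

text \<open>
  Independence in the library is a property of a set, so injectivity is needed to exclude
  repetitions in the list.
\<close>

definition linearly_independent_matrices :: "('m::finite \<Rightarrow> 'a::field^'q^'p) \<Rightarrow> bool"
  where "linearly_independent_matrices A \<longleftrightarrow> inj A \<and> matrix_space.independent (range A)"

lemma linearly_independent_matrices_iff:
  fixes A :: "'m::finite \<Rightarrow> 'a::field^'q^'p"
  shows "linearly_independent_matrices A \<longleftrightarrow>
    (\<forall>c. (\<Sum>i\<in>UNIV. matrix_scale (c i) (A i)) = 0 \<longrightarrow> (\<forall>i. c i = 0))"
    (is "_ \<longleftrightarrow> ?R")
proof
  assume L: "linearly_independent_matrices A"
  then have inj: "inj A" and ind: "matrix_space.independent (range A)"
    by (auto simp: linearly_independent_matrices_def)
  show ?R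
  proof (intro allI impI)
    fix c i assume z: "(\<Sum>i\<in>UNIV. matrix_scale (c i) (A i)) = 0"
    have "(\<Sum>v\<in>range A. matrix_scale (c (inv A v)) v) = 0"
      using z inj by (simp add: sum.reindex)
    from matrix_space.independentD[OF ind _ _ this, of "A i"] show "c i = 0"
      using inj by simp
  qed
next
  assume R: ?R
  have inj: "inj A"
  proof (rule injI, rule ccontr)
    fix i j assume eq: "A i = A j" and ne: "i \<noteq> j"
    let ?c = "\<lambda>k. if k = i then 1 else if k = j then - 1 else (0::'a)"
    have "(\<Sum>k\<in>UNIV. matrix_scale (?c k) (A k)) = (\<Sum>k\<in>{i, j}. matrix_scale (?c k) (A k))"
      by (rule sum.mono_neutral_right) auto
    also have "\<dots> = 0"
      using ne eq by simp
    finally have "?c i = 0"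
      by (rule R[rule_format, of ?c i])
    then show False by simp
  qed
  moreover have "matrix_space.independent (range A)"
  proof
    assume "matrix_space.dependent (range A)"
    then obtain u v where "v \<in> range A" "u v \<noteq> 0" "(\<Sum>v\<in>range A. matrix_scale (u v) v) = 0"
      by (auto simp: matrix_space.dependent_finite)
    moreover from this have "(\<Sum>i\<in>UNIV. matrix_scale (u (A i)) (A i)) = 0"
      using inj by (simp add: sum.reindex)
    ultimately show False
      using R[rule_format, of "\<lambda>i. u (A i)"] by auto
  qed
  ultimately show "linearly_independent_matrices A"
    by (simp add: linearly_independent_matrices_def)
qed

text \<open>
  The product \<open>y\<^sup>T A x\<close> has no complex conjugation: \<^const>\<open>scalar_product\<close> is the plain sum of
  the products of the entries.
\<close>

definition bilinear_system_solution ::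
    "('m::finite \<Rightarrow> 'a::field^'q^'p) \<Rightarrow> 'a^'m \<Rightarrow> 'a^'q \<Rightarrow> 'a^'p \<Rightarrow> bool"
  where "bilinear_system_solution A g x y \<longleftrightarrow> (\<forall>i. scalar_product y (A i *v x) = g $ i)"

definition always_solvable :: "('m::finite \<Rightarrow> 'a::field^'q^'p) \<Rightarrow> bool"
  where "always_solvable A \<longleftrightarrow> (\<forall>g. \<exists>x y. bilinear_system_solution A g x y)"

end

theory Submission
  imports Defs
begin

text \<open>
  Suppose \<open>m \<ge> p + q\<close> and let \<open>F (x, y) = (y\<^sup>T A\<^sub>i x)\<^sub>i\<close>. Over a finite field, a surjection from
  \<open>\<bbbF>\<^sup>q \<times> \<bbbF>\<^sup>p\<close> onto the at least as large \<open>\<bbbF>\<^sup>m\<close> is injective, but \<open>F\<close> vanishes on \<open>0 \<times> \<bbbF>\<^sup>p\<close>.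
  Over the real or complex numbers, \<open>F (c x, c\<inverse> y) = F (x, y)\<close>, so every nonzero value of \<open>F\<close> is
  taken on one of the hyperplanes \<open>x\<^sub>k = 1\<close>. These are null sets, and their images under the
  smooth map \<open>F\<close> into a space of at least the same dimension are null sets too, hence \<open>F\<close> cannot
  be onto.
\<close>

definition bilinear_map :: "('m::finite \<Rightarrow> 'a::field^'q^'p) \<Rightarrow> 'a^'q \<Rightarrow> 'a^'p \<Rightarrow> 'a^'m"
  where "bilinear_map A x y = (\<chi> i. scalar_product y (A i *v x))"

lemma bilinear_map_nth:
  "bilinear_map A x y $ i = (\<Sum>j\<in>UNIV. \<Sum>k\<in>UNIV. y $ j * (A i $ j $ k * x $ k))"
  by (simp add: bilinear_map_def scalar_product_def matrix_vector_mult_def sum_distrib_left)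

lemma always_solvable_iff_surj:
  "always_solvable A \<longleftrightarrow> surj (\<lambda>(x, y). bilinear_map A x y)"
proof -
  have "bilinear_system_solution A g x y \<longleftrightarrow> g = bilinear_map A x y" for g x y
    by (auto simp: bilinear_system_solution_def bilinear_map_def vec_eq_iff)
  then show ?thesis
    by (simp add: always_solvable_def surj_def)
qed

lemma bilinear_map_zero_left [simp]: "bilinear_map A 0 y = 0"
  by (simp add: vec_eq_iff bilinear_map_nth)

lemma bilinear_map_rescale:
  assumes "c \<noteq> 0"
  shows "bilinear_map A (c *s x) (inverse c *s y) = bilinear_map A x y"
  using assms by (simp add: vec_eq_iff bilinear_map_nth field_simps)

text \<open>The sort covers \<open>real\<close> and \<open>complex\<close> at once; linearity is
  over the reals, as the derivatives and null sets below require.\<close>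

lemma bilinear_bilinear_map:
  fixes A :: "'m::finite \<Rightarrow> ('a::{real_normed_field,euclidean_space})^'q^'p"
  shows "bilinear (bilinear_map A)"
  unfolding bilinear_def
  by (auto intro!: linearI
      simp: vec_eq_iff bilinear_map_nth algebra_simps sum.distrib scaleR_sum_right)

lemma differentiable_bilinear_map:
  fixes A :: "'m::finite \<Rightarrow> ('a::{real_normed_field,euclidean_space})^'q^'p"
  shows "(\<lambda>(x, y). bilinear_map A x y) differentiable_on S"
proof -
  have "bounded_bilinear (bilinear_map A)"
    using bilinear_bilinear_map bilinear_conv_bounded_bilinear by blast
  from bounded_bilinear.FDERIV[OF this has_derivative_fst has_derivative_snd,
      OF has_derivative_ident has_derivative_ident]
  show ?thesis
    unfolding differentiable_on_def differentiable_def case_prod_unfold by blast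
qed

text \<open>Pairing with \<open>axis k 1\<close> under the real inner product puts the set inside a
  real hyperplane. Over the complex numbers this keeps only the condition that the real part of the
  coordinate is 1, which is enough.\<close>

lemma negligible_coordinate_eq_1:
  fixes k :: "'q::finite"
  shows "negligible {z :: (('a::{real_normed_field,euclidean_space})^'q) \<times> 'b::euclidean_space.
    fst z $ k = 1}"
proof (rule negligible_subset)
  let ?a = "(axis k 1, 0) :: ('a^'q) \<times> 'b"
  show "negligible {z. ?a \<bullet> z = 1 \<bullet> (1::'a)}"
    by (rule negligible_hyperplane) simp
  show "{z. fst z $ k = 1} \<subseteq> {z :: ('a^'q) \<times> 'b. ?a \<bullet> z = 1 \<bullet> (1::'a)}"
    by (auto simp: inner_prod_def inner_axis')
qed

lemma always_solvable_imp_card_less_euclidean: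
  fixes A :: "'m::finite \<Rightarrow> ('a::{real_normed_field,euclidean_space})^'q::finite^'p::finite"
  assumes "always_solvable A"
  shows "CARD('m) < CARD('p) + CARD('q)"
proof (rule ccontr)
  assume "\<not> ?thesis"
  then have "(CARD('q) + CARD('p)) * DIM('a) \<le> CARD('m) * DIM('a)"
    by (intro mult_right_mono) auto
  then have dim: "DIM(('a^'q) \<times> ('a^'p)) \<le> DIM('a^'m)"
    by (simp add: algebra_simps)
  let ?F = "\<lambda>(x, y). bilinear_map A x y"
  let ?H = "\<lambda>k. {z :: ('a^'q) \<times> ('a^'p). fst z $ k = 1}"
  have "negligible (\<Union>k. ?F ` ?H k)"
    by (intro negligible_Union)
      (auto intro!: negligible_differentiable_image_negligible[OF dim]
        negligible_coordinate_eq_1 differentiable_bilinear_map)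
  \<comment> \<open>The point 0 is added separately because a pair with \<open>x = 0\<close> cannot
    be rescaled onto any of the hyperplanes.\<close>
  moreover have "UNIV \<subseteq> insert 0 (\<Union>k. ?F ` ?H k)"
  proof
    fix g :: "'a^'m"
    obtain x y where g: "g = bilinear_map A x y"
      using assms unfolding always_solvable_iff_surj surj_def by (force simp: case_prod_unfold)
    show "g \<in> insert 0 (\<Union>k. ?F ` ?H k)"
    proof (cases "x = 0")
      case False
      then obtain k where k: "x $ k \<noteq> 0"
        by (auto simp: vec_eq_iff)
      then have "g = ?F (inverse (x $ k) *s x, x $ k *s y)"
        using bilinear_map_rescale[of "inverse (x $ k)" A x y] g by simp
      moreover have "(inverse (x $ k) *s x, x $ k *s y) \<in> ?H k"
        using k by simp
      ultimately show ?thesis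
        by blast
    qed (simp add: g)
  qed
  ultimately show False
    by (metis negligible_insert negligible_subset non_negligible_UNIV)
qed

lemma always_solvable_imp_card_less_finite:
  fixes A :: "'m::finite \<Rightarrow> ('a::{field,finite})^'q::finite^'p::finite"
  assumes "always_solvable A"
  shows "CARD('m) < CARD('p) + CARD('q)"
proof (rule ccontr)
  assume "\<not> ?thesis"
  then have "CARD('a) ^ (CARD('q) + CARD('p)) \<le> CARD('a) ^ CARD('m)"
    by (intro power_increasing) (auto simp: Suc_leI)
  then have le: "CARD(('a^'q) \<times> ('a^'p)) \<le> CARD('a^'m)"
    by (simp add: power_add)
  let ?F = "\<lambda>(x, y). bilinear_map A x y"
  have surj: "range ?F = UNIV"
    using assms by (simp add: always_solvable_iff_surj)
  have "card (range ?F) \<le> CARD(('a^'q) \<times> ('a^'p))"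
    by (rule card_image_le) simp
  \<comment> \<open>By surjectivity the image has the size of the target, so \<open>le\<close> is
    the reverse inequality.\<close>
  with le have "card (range ?F) = CARD(('a^'q) \<times> ('a^'p))"
    unfolding surj by (rule antisym[rotated])
  then have "inj ?F"
    by (intro eq_card_imp_inj_on) simp_all
  \<comment> \<open>Here \<open>1\<close> is the all-ones vector, serving as a nonzero
    \<open>y\<close>.\<close>
  moreover have "?F (0, 0) = ?F (0, 1)"
    by simp
  ultimately show False
    using injD[of ?F "(0, 0)" "(0, 1)"] by (simp add: vec_eq_iff)
qed

theorem theorem5p2:
  shows "(\<forall>A :: 'm::finite \<Rightarrow> real^'q::finite^'p::finite.
            linearly_independent_matrices A \<longrightarrow> always_solvable A \<longrightarrow>
            CARD('m) \<le> CARD('p) + CARD('q) - 1) \<and>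
         (\<forall>A :: 'm \<Rightarrow> complex^'q^'p.
            linearly_independent_matrices A \<longrightarrow> always_solvable A \<longrightarrow>
            CARD('m) \<le> CARD('p) + CARD('q) - 1) \<and>
         (\<forall>A :: 'm \<Rightarrow> ('f::{field,finite})^'q^'p.
            linearly_independent_matrices A \<longrightarrow> always_solvable A \<longrightarrow>
            CARD('m) \<le> CARD('p) + CARD('q) - 1)"
  using always_solvable_imp_card_less_euclidean[where 'a = real]
    always_solvable_imp_card_less_euclidean[where 'a = complex]
    always_solvable_imp_card_less_finite[where 'a = 'f]
  \<comment> \<open>The truncated subtraction is removed by passing to m + 1 \<le> p + q, which is
    the strict bound already obtained.\<close>
  by (intro conjI allI impI add_le_imp_le_diff) (simp_all add: less_eq_Suc_le)

end
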